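(* The following forward proof-search procedure FSearch is adequate: for every formula $G$, FSearch$(G)$ terminates and returns either an $\mathbf{FRJ}(G)$-derivation of $G$ or a saturated database for $G$. Procedure: maintain a set $DB$ (initially empty), a set $I$ (initially the set of all axiom sequents of $\mathbf{FRJ}(G)$) and a set of derivations (initially the axioms). While $I\neq\emptyset$ and $DB$ contains no regular sequent of the form $\Gamma\Rightarrow G$: set $DB:=DB\cup I$ and $I:=\emptyset$; for every instance of a rule of $\mathbf{FRJ}(G)$ all of whose premises belong to $DB$, with conclusion $\sigma$, if $DB$ contains no $\sigma'$ with $\sigma\sqsubseteq\sigma'$, then add $\sigma$ to $I$ and record the derivation of $\sigma$ obtained by applying the rule to the recorded derivations of its premises. At the end, if $DB$ contains some $\Gamma\Rightarrow G$ return its recorded derivation, otherwise return $DB$.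
   Context: Formulas are built from a countably infinite set $\mathcal{V}$ of propositional variables and $\bot$ using $\land,\lor,\supset$. Let $\mathcal{V}_\bot=\mathcal{V}\cup\{\bot\}$, $\mathcal{L}^{\supset}$ the set of formulas with main connective $\supset$. For a formula $G$, $\mathrm{Sl}(G)$ and $\mathrm{Sr}(G)$ are the smallest subsets of the subformulas of $G$ with: $G\in\mathrm{Sr}(G)$; $A\land B$ or $A\lor B$ in $\mathrm{Sl}(G)$ (resp. $\mathrm{Sr}(G)$) implies $A,B$ in $\mathrm{Sl}(G)$ (resp. $\mathrm{Sr}(G)$); $A\supset B\in\mathrm{Sl}(G)$ implies $B\in\mathrm{Sl}(G)$, $A\in\mathrm{Sr}(G)$; $A\supset B\in\mathrm{Sr}(G)$ implies $B\in\mathrm{Sr}(G)$, $A\in\mathrm{Sl}(G)$. $\mathrm{Cl}(\Gamma)$ is the smallest set containing $\Gamma$ such that if $X,Y\in\mathrm{Cl}(\Gamma)$ and $A$ is any formula then $X\land Y,A\lor X,X\lor A,A\supset X\in\mathrm{Cl}(\Gamma)$. $\mathbf{FRJ}(G)$: let $\bar\Gamma^{At}=\mathrm{Sl}(G)\cap\mathcal V$, $\bar\Gamma^{\supset}=\mathrm{Sl}(G)\cap\mathcal L^{\supset}$, $\bar\Gamma=\bar\Gamma^{At}\cup\bar\Gamma^{\supset}$. Sequents: regular $\Gamma\Rightarrow C$ ($\Gamma\subseteq\bar\Gamma$, $C\in\mathrm{Sr}(G)$), irregular $\Sigma;\Theta\rightarrow C$ ($\Sigma\cup\Theta\subseteq\bar\Gamma$,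 $C\in\mathrm{Sr}(G)$); conclusions always have right formula in $\mathrm{Sr}(G)$. Rules ($F\in\mathcal V_\bot$, $k\in\{1,2\}$): axioms $\bar\Gamma^{At}\setminus\{F\}\Rightarrow F$ and $\emptyset;(\bar\Gamma^{At}\setminus\{F\})\cup\bar\Gamma^{\supset}\rightarrow F$; ($\land$) $\Gamma\Rightarrow A_k/\Gamma\Rightarrow A_1\land A_2$ and $\Sigma;\Theta\rightarrow A_k/\Sigma;\Theta\rightarrow A_1\land A_2$; ($\lor$) $\Sigma_1;\Theta_1\rightarrow C_1$, $\Sigma_2;\Theta_2\rightarrow C_2 / \Sigma_1\cup\Sigma_2;\Theta_1\cap\Theta_2\rightarrow C_1\lor C_2$ if $\Sigma_1\subseteq\Sigma_2\cup\Theta_2$, $\Sigma_2\subseteq\Sigma_1\cup\Theta_1$; ($\supset_\in$) $\Gamma\Rightarrow B/\Gamma\Rightarrow A\supset B$ if $A\in\mathrm{Cl}(\Gamma)$, and $\Sigma;\Theta\cup\Lambda\rightarrow B/\Sigma\cup\Lambda;\Theta\rightarrow A\supset B$ if $\Theta\cap\Lambda=\emptyset$, $A\in\mathrm{Cl}(\Sigma\cup\Lambda)$ and no $\Lambda'\subsetneq\Lambda$ has $A\in\mathrm{Cl}(\Sigma\cup\Lambda')$; ($\supset_{\notin}$) $\Gamma\Rightarrow B/\emptyset;\Theta\rightarrow A\supset B$ if $\Theta\subseteq\mathrm{Cl}(\Gamma)\cap\bar\Gamma$, $A\in\mathrm{Cl}(\Gamma)\setminus\mathrm{Cl}(\Theta)$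 and every $\Theta'$ with $\Theta\subsetneq\Theta'\subseteq\mathrm{Cl}(\Gamma)\cap\bar\Gamma$ has $A\in\mathrm{Cl}(\Theta')$; join rules with premises $\Sigma_j;\Theta_j\rightarrow A_j$ ($1\le j\le n$, $n\ge1$): let $\Upsilon=\{A_1,\dots,A_n\}$, $\Sigma^{At}=\bigcup_j(\Sigma_j\cap\mathcal V)$, $\Sigma^{\supset}=\bigcup_j(\Sigma_j\cap\mathcal L^{\supset})$, $\Theta^{At}=\bigcap_j(\Theta_j\cap\mathcal V)$, $\Theta^{\supset}=\{Y\supset Z\in\bigcap_j(\Theta_j\cap\mathcal L^{\supset}):Y\in\Upsilon\}$, requiring $\Sigma_i\subseteq\Sigma_j\cup\Theta_j$ ($i\ne j$) and ($Y\supset Z\in\Sigma^{\supset}\Rightarrow Y\in\Upsilon$); ($\bowtie^{At}$) conclusion $\Sigma^{At}\cup(\Theta^{At}\setminus\{F\})\cup\Sigma^{\supset}\cup\Theta^{\supset}\Rightarrow F$, $F\in\mathcal V_\bot\setminus\Sigma^{At}$, where each $Y\in\Upsilon$ has some $Y\supset Z\in\mathrm{Sl}(G)$; ($\bowtie^{\lor}$) conclusion $\Sigma^{At}\cup\Theta^{At}\cup\Sigma^{\supset}\cup\Theta^{\supset}\Rightarrow C_1\lor C_2$, $\{C_1,C_2\}\subseteq\Upsilon$, where each $Y\in\Upsilon$ has some $Y\supset Z\in\mathrm{Sl}(G)$ or $Y\lor Z\in\mathrm{Sr}(G)$ or $Z\lor Y\in\mathrm{Sr}(G)$. An $\mathbf{FRJ}(G)$-derivation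 of $G$ is a derivation of some regular sequent $\Gamma\Rightarrow G$. Subsumption: $\sigma_1\sqsubseteq\sigma_2$ iff either $\sigma_1=\Gamma_1\Rightarrow C$, $\sigma_2=\Gamma_2\Rightarrow C$ with $\Gamma_1\subseteq\Gamma_2$, or $\sigma_1=\Sigma;\Theta_1\rightarrow C$, $\sigma_2=\Sigma;\Theta_2\rightarrow C$ (same $\Sigma$, same $C$) with $\Theta_1\subseteq\Theta_2$. A database for $G$ is a set of $\mathbf{FRJ}(G)$-sequents each derivable in $\mathbf{FRJ}(G)$; it is saturated if for every derivable $\mathbf{FRJ}(G)$-sequent $\sigma$ it contains some $\sigma'$ with $\sigma\sqsubseteq\sigma'$. *)

theory Defs
  imports Main
begin

section \<open>Formulas\<close>

datatype form =
    Var nat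
  | Bot
  | And form form
  | Or form form
  | Imp form form

definition Vars :: "form set" where
  "Vars = range Var"

definition Vars_bot :: "form set" where
  "Vars_bot = insert Bot Vars"

definition Imps :: "form set" where
  "Imps = {Imp A B | A B. True}"

text \<open>All elements of \<open>Sl G\<close> and \<open>Sr G\<close> are subformulas of \<open>G\<close>, so the inductive sets coincide
  with the least such subsets of the set of subformulas.\<close>

inductive_set Sl :: "form \<Rightarrow> form set" and Sr :: "form \<Rightarrow> form set" for G :: form where
  Sr_self: "G \<in> Sr G"
| Sl_And1: "And A B \<in> Sl G \<Longrightarrow> A \<in> Sl G"
| Sl_And2: "And A B \<in> Sl G \<Longrightarrow> B \<in> Sl G"
| Sl_Or1: "Or A B \<in> Sl G \<Longrightarrow> A \<in> Sl G"
| Sl_Or2: "Or A B \<in> Sl G \<Longrightarrow> B \<in> Sl G"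
| Sr_And1: "And A B \<in> Sr G \<Longrightarrow> A \<in> Sr G"
| Sr_And2: "And A B \<in> Sr G \<Longrightarrow> B \<in> Sr G"
| Sr_Or1: "Or A B \<in> Sr G \<Longrightarrow> A \<in> Sr G"
| Sr_Or2: "Or A B \<in> Sr G \<Longrightarrow> B \<in> Sr G"
| Sl_Imp_r: "Imp A B \<in> Sl G \<Longrightarrow> B \<in> Sl G"
| Sl_Imp_l: "Imp A B \<in> Sl G \<Longrightarrow> A \<in> Sr G"
| Sr_Imp_r: "Imp A B \<in> Sr G \<Longrightarrow> B \<in> Sr G"
| Sr_Imp_l: "Imp A B \<in> Sr G \<Longrightarrow> A \<in> Sl G"

inductive_set Cl :: "form set \<Rightarrow> form set" for \<Gamma> :: "form set" where
  Cl_base: "X \<in> \<Gamma> \<Longrightarrow> X \<in> Cl \<Gamma>"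
| Cl_And: "X \<in> Cl \<Gamma> \<Longrightarrow> Y \<in> Cl \<Gamma> \<Longrightarrow> And X Y \<in> Cl \<Gamma>"
| Cl_Or1: "X \<in> Cl \<Gamma> \<Longrightarrow> Or A X \<in> Cl \<Gamma>"
| Cl_Or2: "X \<in> Cl \<Gamma> \<Longrightarrow> Or X A \<in> Cl \<Gamma>"
| Cl_Imp: "X \<in> Cl \<Gamma> \<Longrightarrow> Imp A X \<in> Cl \<Gamma>"

section \<open>The calculus FRJ(G)\<close>

definition bar_At :: "form \<Rightarrow> form set" where
  "bar_At G = Sl G \<inter> Vars"

definition bar_Imp :: "form \<Rightarrow> form set" where
  "bar_Imp G = Sl G \<inter> Imps"

definition bar :: "form \<Rightarrow> form set" where
  "bar G = bar_At G \<union> bar_Imp G"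

text \<open>\<open>Reg \<Gamma> C\<close> is the regular sequent \<open>\<Gamma> \<Rightarrow> C\<close>; \<open>Irr \<Sigma> \<Theta> C\<close> is the irregular
  sequent \<open>\<Sigma>; \<Theta> \<rightarrow> C\<close>.\<close>

datatype sequent =
    Reg "form set" form
  | Irr "form set" "form set" form

fun frj_sequent :: "form \<Rightarrow> sequent \<Rightarrow> bool" where
  "frj_sequent G (Reg \<Gamma> C) \<longleftrightarrow> \<Gamma> \<subseteq> bar G \<and> C \<in> Sr G"
| "frj_sequent G (Irr \<Sigma> \<Theta> C) \<longleftrightarrow> \<Sigma> \<union> \<Theta> \<subseteq> bar G \<and> C \<in> Sr G"

inductive axiom_schema :: "form \<Rightarrow> sequent \<Rightarrow> bool" for G :: form where
  ax_reg: "F \<in> Vars_bot \<Longrightarrow> axiom_schema G (Reg (bar_At G - {F}) F)"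
| ax_irr: "F \<in> Vars_bot \<Longrightarrow> axiom_schema G (Irr {} ((bar_At G - {F}) \<union> bar_Imp G) F)"

text \<open>Ingredients of the join rules, for premises \<open>\<Sigma> j; \<Theta> j \<rightarrow> A j\<close> with \<open>j < n\<close>.\<close>

definition Ups :: "nat \<Rightarrow> (nat \<Rightarrow> form) \<Rightarrow> form set" where
  "Ups n A = A ` {..<n}"

definition Sig_At :: "nat \<Rightarrow> (nat \<Rightarrow> form set) \<Rightarrow> form set" where
  "Sig_At n \<Sigma> = (\<Union>j<n. \<Sigma> j \<inter> Vars)"

definition Sig_Imp :: "nat \<Rightarrow> (nat \<Rightarrow> form set) \<Rightarrow> form set" where
  "Sig_Imp n \<Sigma> = (\<Union>j<n. \<Sigma> j \<inter> Imps)"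

definition The_At :: "nat \<Rightarrow> (nat \<Rightarrow> form set) \<Rightarrow> form set" where
  "The_At n \<Theta> = (\<Inter>j<n. \<Theta> j \<inter> Vars)"

definition The_Imp :: "nat \<Rightarrow> (nat \<Rightarrow> form set) \<Rightarrow> (nat \<Rightarrow> form) \<Rightarrow> form set" where
  "The_Imp n \<Theta> A = {Imp Y Z | Y Z. Imp Y Z \<in> (\<Inter>j<n. \<Theta> j \<inter> Imps) \<and> Y \<in> Ups n A}"

definition join_cond ::
  "nat \<Rightarrow> (nat \<Rightarrow> form set) \<Rightarrow> (nat \<Rightarrow> form set) \<Rightarrow> (nat \<Rightarrow> form) \<Rightarrow> bool" where
  "join_cond n \<Sigma> \<Theta> A \<longleftrightarrow> n \<ge> 1
     \<and> (\<forall>i<n. \<forall>j<n. i \<noteq> j \<longrightarrow> \<Sigma> i \<subseteq> \<Sigma> j \<union> \<Theta> j)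
     \<and> (\<forall>Y Z. Imp Y Z \<in> Sig_Imp n \<Sigma> \<longrightarrow> Y \<in> Ups n A)"

definition join_prems ::
  "nat \<Rightarrow> (nat \<Rightarrow> form set) \<Rightarrow> (nat \<Rightarrow> form set) \<Rightarrow> (nat \<Rightarrow> form) \<Rightarrow> sequent list" where
  "join_prems n \<Sigma> \<Theta> A = map (\<lambda>j. Irr (\<Sigma> j) (\<Theta> j) (A j)) [0..<n]"

inductive rule_schema :: "form \<Rightarrow> sequent list \<Rightarrow> sequent \<Rightarrow> bool" for G :: form where
  and_reg: "C \<in> {A1, A2} \<Longrightarrow> rule_schema G [Reg \<Gamma> C] (Reg \<Gamma> (And A1 A2))"
| and_irr: "C \<in> {A1, A2} \<Longrightarrow> rule_schema G [Irr \<Sigma> \<Theta> C] (Irr \<Sigma> \<Theta> (And A1 A2))"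
| or_irr: "\<Sigma>1 \<subseteq> \<Sigma>2 \<union> \<Theta>2 \<Longrightarrow> \<Sigma>2 \<subseteq> \<Sigma>1 \<union> \<Theta>1 \<Longrightarrow>
    rule_schema G [Irr \<Sigma>1 \<Theta>1 C1, Irr \<Sigma>2 \<Theta>2 C2]
      (Irr (\<Sigma>1 \<union> \<Sigma>2) (\<Theta>1 \<inter> \<Theta>2) (Or C1 C2))"
| imp_in_reg: "A \<in> Cl \<Gamma> \<Longrightarrow> rule_schema G [Reg \<Gamma> B] (Reg \<Gamma> (Imp A B))"
| imp_in_irr: "\<Theta> \<inter> \<Lambda> = {} \<Longrightarrow> A \<in> Cl (\<Sigma> \<union> \<Lambda>) \<Longrightarrow>
    \<not> (\<exists>\<Lambda>'. \<Lambda>' \<subset> \<Lambda> \<and> A \<in> Cl (\<Sigma> \<union> \<Lambda>')) \<Longrightarrow>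
    rule_schema G [Irr \<Sigma> (\<Theta> \<union> \<Lambda>) B] (Irr (\<Sigma> \<union> \<Lambda>) \<Theta> (Imp A B))"
| imp_notin: "\<Theta> \<subseteq> Cl \<Gamma> \<inter> bar G \<Longrightarrow> A \<in> Cl \<Gamma> - Cl \<Theta> \<Longrightarrow>
    (\<forall>\<Theta>'. \<Theta> \<subset> \<Theta>' \<and> \<Theta>' \<subseteq> Cl \<Gamma> \<inter> bar G \<longrightarrow> A \<in> Cl \<Theta>') \<Longrightarrow>
    rule_schema G [Reg \<Gamma> B] (Irr {} \<Theta> (Imp A B))"
| join_At: "join_cond n \<Sigma> \<Theta> A \<Longrightarrow> F \<in> Vars_bot - Sig_At n \<Sigma> \<Longrightarrow>
    (\<forall>Y \<in> Ups n A. \<exists>Z. Imp Y Z \<in> Sl G) \<Longrightarrow>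
    rule_schema G (join_prems n \<Sigma> \<Theta> A)
      (Reg (Sig_At n \<Sigma> \<union> (The_At n \<Theta> - {F}) \<union> Sig_Imp n \<Sigma> \<union> The_Imp n \<Theta> A) F)"
| join_Or: "join_cond n \<Sigma> \<Theta> A \<Longrightarrow> {C1, C2} \<subseteq> Ups n A \<Longrightarrow>
    (\<forall>Y \<in> Ups n A. \<exists>Z. Imp Y Z \<in> Sl G \<or> Or Y Z \<in> Sr G \<or> Or Z Y \<in> Sr G) \<Longrightarrow>
    rule_schema G (join_prems n \<Sigma> \<Theta> A)
      (Reg (Sig_At n \<Sigma> \<union> The_At n \<Theta> \<union> Sig_Imp n \<Sigma> \<union> The_Imp n \<Theta> A) (Or C1 C2))"

text \<open>The schemas above do not restrict right formulas to \<open>Sr G\<close>; instances of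
  axioms and rules of FRJ(G) consist of FRJ(G)-sequents only.\<close>

definition frj_axiom :: "form \<Rightarrow> sequent \<Rightarrow> bool" where
  "frj_axiom G \<sigma> \<longleftrightarrow> axiom_schema G \<sigma> \<and> frj_sequent G \<sigma>"

definition frj_rule :: "form \<Rightarrow> sequent list \<Rightarrow> sequent \<Rightarrow> bool" where
  "frj_rule G Ps \<sigma> \<longleftrightarrow>
     rule_schema G Ps \<sigma> \<and> (\<forall>\<tau> \<in> set Ps. frj_sequent G \<tau>) \<and> frj_sequent G \<sigma>"

datatype deriv = Node (root: sequent) (subderivs: "deriv list")

inductive frj_derivation :: "form \<Rightarrow> deriv \<Rightarrow> bool" for G :: form where
  der_axiom: "frj_axiom G \<sigma> \<Longrightarrow> frj_derivation G (Node \<sigma> [])"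
| der_rule: "frj_rule G (map root ds) \<sigma> \<Longrightarrow> \<forall>d \<in> set ds. frj_derivation G d \<Longrightarrow>
    frj_derivation G (Node \<sigma> ds)"

definition frj_derivable :: "form \<Rightarrow> sequent \<Rightarrow> bool" where
  "frj_derivable G \<sigma> \<longleftrightarrow> (\<exists>d. frj_derivation G d \<and> root d = \<sigma>)"

definition frj_derivation_of_goal :: "form \<Rightarrow> deriv \<Rightarrow> bool" where
  "frj_derivation_of_goal G d \<longleftrightarrow> frj_derivation G d \<and> (\<exists>\<Gamma>. root d = Reg \<Gamma> G)"

section \<open>Subsumption and databases\<close>

inductive subsumed :: "sequent \<Rightarrow> sequent \<Rightarrow> bool" (infix "\<sqsubseteq>" 50) where
  sub_reg: "\<Gamma>1 \<subseteq> \<Gamma>2 \<Longrightarrow> Reg \<Gamma>1 C \<sqsubseteq> Reg \<Gamma>2 C"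
| sub_irr: "\<Theta>1 \<subseteq> \<Theta>2 \<Longrightarrow> Irr \<Sigma> \<Theta>1 C \<sqsubseteq> Irr \<Sigma> \<Theta>2 C"

definition database :: "form \<Rightarrow> sequent set \<Rightarrow> bool" where
  "database G DB \<longleftrightarrow> (\<forall>\<sigma> \<in> DB. frj_sequent G \<sigma> \<and> frj_derivable G \<sigma>)"

definition saturated_database :: "form \<Rightarrow> sequent set \<Rightarrow> bool" where
  "saturated_database G DB \<longleftrightarrow> database G DB \<and>
     (\<forall>\<sigma>. frj_sequent G \<sigma> \<and> frj_derivable G \<sigma> \<longrightarrow> (\<exists>\<sigma>' \<in> DB. \<sigma> \<sqsubseteq> \<sigma>'))"

section \<open>The procedure FSearch\<close>

text \<open>FSearch is given by a small-step semantics. \<open>While DB I D\<close> is a configuration at the test of the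
  while loop, where \<open>D\<close> is the set of recorded derivations; \<open>For DB I D P\<close> is a configuration inside the
  for loop, where \<open>P\<close> are the rule instances still to be visited; \<open>Done r\<close> is a
  configuration where \<open>r\<close> has been returned. The order in which instances are visited, and the
  choice among several recorded derivations of one sequent, are left open.

  An instance visited by the for loop is identified by its conclusion and the set of its premises: instances of
  a join rule that differ only in the order or the repetition of premises count as one. (Join rules
  take arbitrarily long lists of premises, so there would otherwise be infinitely many instances
  to visit.)\<close>

datatype result = Derivation deriv | Database "sequent set"

datatype config =
    While "sequent set" "sequent set" "deriv set"
  | For "sequent set" "sequent set" "deriv set" "(sequent set \<times> sequent) set"
  | Done result

definition instances :: "form \<Rightarrow> sequent set \<Rightarrow> (sequent set \<times> sequent) set" where
  "instances G DB = {(set Ps, \<sigma>) | Ps \<sigma>. frj_rule G Ps \<sigma> \<and> set Ps \<subseteq> DB}"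

definition goal_found :: "form \<Rightarrow> sequent set \<Rightarrow> bool" where
  "goal_found G DB \<longleftrightarrow> (\<exists>\<Gamma>. Reg \<Gamma> G \<in> DB)"

definition fsearch_init :: "form \<Rightarrow> config" where
  "fsearch_init G = While {} {\<sigma>. frj_axiom G \<sigma>} {Node \<sigma> [] | \<sigma>. frj_axiom G \<sigma>}"

inductive fsearch_step :: "form \<Rightarrow> config \<Rightarrow> config \<Rightarrow> bool" for G :: form where
  enter: "I \<noteq> {} \<Longrightarrow> \<not> goal_found G DB \<Longrightarrow>
    fsearch_step G (While DB I D) (For (DB \<union> I) {} D (instances G (DB \<union> I)))"
| skip: "(S, \<sigma>) \<in> P \<Longrightarrow> \<exists>\<sigma>' \<in> DB. \<sigma> \<sqsubseteq> \<sigma>' \<Longrightarrow>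
    fsearch_step G (For DB I D P) (For DB I D (P - {(S, \<sigma>)}))"
| add: "(S, \<sigma>) \<in> P \<Longrightarrow> \<not> (\<exists>\<sigma>' \<in> DB. \<sigma> \<sqsubseteq> \<sigma>') \<Longrightarrow>
    set ds \<subseteq> D \<Longrightarrow> set (map root ds) = S \<Longrightarrow> frj_rule G (map root ds) \<sigma> \<Longrightarrow>
    fsearch_step G (For DB I D P) (For DB (insert \<sigma> I) (insert (Node \<sigma> ds) D) (P - {(S, \<sigma>)}))"
| leave: "fsearch_step G (For DB I D {}) (While DB I D)"
| return_derivation: "Reg \<Gamma> G \<in> DB \<Longrightarrow> d \<in> D \<Longrightarrow> root d = Reg \<Gamma> G \<Longrightarrow>
    fsearch_step G (While DB I D) (Done (Derivation d))"
| return_database: "I = {} \<Longrightarrow> \<not> goal_found G DB \<Longrightarrow>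
    fsearch_step G (While DB I D) (Done (Database DB))"

definition fsearch_reaches :: "form \<Rightarrow> config \<Rightarrow> bool" where
  "fsearch_reaches G c \<longleftrightarrow> (fsearch_step G)\<^sup>*\<^sup>* (fsearch_init G) c"

text \<open>Termination: no run is infinite, and no run gets stuck before returning a result.\<close>

definition fsearch_terminates :: "form \<Rightarrow> bool" where
  "fsearch_terminates G \<longleftrightarrow>
     \<not> (\<exists>c. c 0 = fsearch_init G \<and> (\<forall>i::nat. fsearch_step G (c i) (c (Suc i)))) \<and>
     (\<forall>c. fsearch_reaches G c \<and> \<not> (\<exists>c'. fsearch_step G c c') \<longrightarrow> (\<exists>r. c = Done r))"

definition fsearch_returns :: "form \<Rightarrow> result \<Rightarrow> bool" where
  "fsearch_returns G r \<longleftrightarrow> fsearch_reaches G (Done r)"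

end

(* Every rule is monotone with respect to subsumption of its premises: enlarging the left-hand sides
   (the sets Sigma of irregular premises staying fixed) allows an instance whose conclusion subsumes
   the old one. Hence a database that subsumes the axioms and the conclusions of all rule instances
   over it subsumes every derivable sequent. Termination holds because there are finitely many
   FRJ(G)-sequents and each round of the while loop enlarges DB: the sequents in I are not
   subsumed by DB, so they are not in DB. *)

theory Submission
  imports Defs
begin

section \<open>Finiteness of the set of sequents\<close>

text \<open>A finite set large enough to contain \<open>Sl G\<close> and \<open>Sr G\<close>, from
  which their finiteness is inherited.\<close>

primrec subforms :: "form \<Rightarrow> form set" where
  "subforms (Var n) = {Var n}"
| "subforms Bot = {Bot}"
| "subforms (And A B) = insert (And A B) (subforms A \<union> subforms B)"
| "subforms (Or A B) = insert (Or A B) (subforms A \<union> subforms B)"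
| "subforms (Imp A B) = insert (Imp A B) (subforms A \<union> subforms B)"

lemma finite_subforms: "finite (subforms A)"
  by (induction A) auto

lemma subforms_refl: "A \<in> subforms A"
  by (cases A) auto

lemma subforms_trans: "A \<in> subforms B \<Longrightarrow> subforms A \<subseteq> subforms B"
  by (induction B) auto

lemma Sl_Sr_subforms:
  "A \<in> Sl G \<Longrightarrow> A \<in> subforms G"
  "B \<in> Sr G \<Longrightarrow> B \<in> subforms G"
  by (induction rule: Sl_Sr.inducts) (use subforms_refl subforms_trans in fastforce)+

lemma finite_Sr: "finite (Sr G)"
  by (rule finite_subset[OF _ finite_subforms[of G]]) (auto intro: Sl_Sr_subforms)

lemma finite_bar: "finite (bar G)"
  by (rule finite_subset[OF _ finite_subforms[of G]])
    (auto simp: bar_def bar_At_def bar_Imp_def intro: Sl_Sr_subforms)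

lemma finite_frj_sequents: "finite {\<sigma>. frj_sequent G \<sigma>}"
proof (rule finite_subset)
  let ?R = "case_prod Reg ` (Pow (bar G) \<times> Sr G)"
  let ?I = "(\<lambda>(\<Sigma>, \<Theta>, C). Irr \<Sigma> \<Theta> C) ` (Pow (bar G) \<times> Pow (bar G) \<times> Sr G)"
  have "Reg \<Gamma> C \<in> ?R" if "frj_sequent G (Reg \<Gamma> C)" for \<Gamma> C
    by (rule rev_image_eqI[of "(\<Gamma>, C)"]) (use that in auto)
  moreover have "Irr \<Sigma> \<Theta> C \<in> ?I" if "frj_sequent G (Irr \<Sigma> \<Theta> C)" for \<Sigma> \<Theta> C
    by (rule rev_image_eqI[of "(\<Sigma>, \<Theta>, C)"]) (use that in auto)
  ultimately have *: "\<sigma> \<in> ?R \<union> ?I" if "frj_sequent G \<sigma>" for \<sigma>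
    using that by (cases \<sigma>) (simp_all only: UnI1 UnI2)
  show "{\<sigma>. frj_sequent G \<sigma>} \<subseteq> ?R \<union> ?I"
    by (rule subsetI, rule *, erule CollectD)
  show "finite (?R \<union> ?I)"
    by (simp add: finite_bar finite_Sr)
qed

text \<open>An instance stores the set of its premises and not the list, so it lies in a finite
  product even though join rules admit arbitrarily long premise lists.\<close>

lemma finite_instances: "finite (instances G DB)"
proof (rule finite_subset)
  show "instances G DB \<subseteq> Pow {\<sigma>. frj_sequent G \<sigma>} \<times> {\<sigma>. frj_sequent G \<sigma>}"
    by (auto simp: instances_def frj_rule_def)
  show "finite (Pow {\<sigma>. frj_sequent G \<sigma>} \<times> {\<sigma>. frj_sequent G \<sigma>})"
    by (simp add: finite_frj_sequents)
qed

section \<open>Subsumption\<close>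

lemma subsumed_refl: "\<sigma> \<sqsubseteq> \<sigma>"
  by (cases \<sigma>) (auto intro: subsumed.intros)

lemma subsumed_trans: "\<sigma> \<sqsubseteq> \<tau> \<Longrightarrow> \<tau> \<sqsubseteq> \<rho> \<Longrightarrow> \<sigma> \<sqsubseteq> \<rho>"
  by (auto elim!: subsumed.cases intro!: subsumed.intros)

lemma Reg_subsumedE:
  assumes "Reg \<Gamma> C \<sqsubseteq> \<tau>"
  obtains \<Gamma>' where "\<tau> = Reg \<Gamma>' C" "\<Gamma> \<subseteq> \<Gamma>'"
  using assms by (auto elim: subsumed.cases)

lemma Irr_subsumedE:
  assumes "Irr \<Sigma> \<Theta> C \<sqsubseteq> \<tau>"
  obtains \<Theta>' where "\<tau> = Irr \<Sigma> \<Theta>' C" "\<Theta> \<subseteq> \<Theta>'"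
  using assms by (auto elim: subsumed.cases)

section \<open>Monotonicity of closures and of the rules with respect to subsumption\<close>

lemma Cl_mono: "\<Gamma> \<subseteq> \<Delta> \<Longrightarrow> Cl \<Gamma> \<subseteq> Cl \<Delta>"
proof
  fix A assume "A \<in> Cl \<Gamma>" "\<Gamma> \<subseteq> \<Delta>"
  then show "A \<in> Cl \<Delta>" by induction (auto intro: Cl.intros)
qed

text \<open>Supplies the maximal \<Theta> that the side condition of \<open>imp_notin\<close>
  demands: among the finitely many subsets of \<open>M\<close> whose closure misses
  \<open>A\<close>, some maximal one lies above the given \<Theta>.\<close>

lemma maximal_set_avoiding_Cl:
  assumes "finite M" "\<Theta> \<subseteq> M" "A \<notin> Cl \<Theta>"
  obtains \<Theta>' where "\<Theta> \<subseteq> \<Theta>'" "\<Theta>' \<subseteq> M" "A \<notin> Cl \<Theta>'"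
    "\<forall>\<Theta>''. \<Theta>' \<subset> \<Theta>'' \<and> \<Theta>'' \<subseteq> M \<longrightarrow> A \<in> Cl \<Theta>''"
proof -
  have "finite {X. X \<subseteq> M \<and> A \<notin> Cl X}"
    by (rule finite_subset[of _ "Pow M"]) (use assms(1) in auto)
  from finite_has_maximal2[OF this, of \<Theta>] assms obtain X where
    "X \<subseteq> M" "A \<notin> Cl X" "\<Theta> \<subseteq> X" "\<forall>Y\<in>{X. X \<subseteq> M \<and> A \<notin> Cl X}. X \<subseteq> Y \<longrightarrow> X = Y"
    by auto
  then show thesis by (intro that[of X]) auto
qed

lemma The_At_mono: "(\<And>j. j < n \<Longrightarrow> \<Theta> j \<subseteq> \<Theta>' j) \<Longrightarrow> The_At n \<Theta> \<subseteq> The_At n \<Theta>'"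
  unfolding The_At_def by (rule INT_anti_mono) auto

lemma The_Imp_mono:
  assumes "\<And>j. j < n \<Longrightarrow> \<Theta> j \<subseteq> \<Theta>' j"
  shows "The_Imp n \<Theta> A \<subseteq> The_Imp n \<Theta>' A"
proof -
  have "(\<Inter>j<n. \<Theta> j \<inter> Imps) \<subseteq> (\<Inter>j<n. \<Theta>' j \<inter> Imps)"
    by (rule INT_anti_mono) (use assms in auto)
  then show ?thesis unfolding The_Imp_def by blast
qed

text \<open>The sets \<Theta> occur only on the right of inclusions; the remaining conditions speak
  of \<open>n\<close>, \<Sigma> and \<open>A\<close>.\<close>

lemma join_cond_mono:
  "join_cond n \<Sigma> \<Theta> A \<Longrightarrow> (\<And>j. j < n \<Longrightarrow> \<Theta> j \<subseteq> \<Theta>' j) \<Longrightarrow> join_cond n \<Sigma> \<Theta>' A"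
  unfolding join_cond_def by (meson Un_mono order_refl order_trans)

text \<open>Subsumption fixes \<Sigma> and the right formula of an irregular sequent, so the
  subsuming list is again a list of join premises with the same \<open>n\<close>, \<Sigma> and
  \<open>A\<close>.\<close>

lemma join_prems_subsumedE:
  assumes "list_all2 (\<sqsubseteq>) (join_prems n \<Sigma> \<Theta> A) Ps"
  obtains \<Theta>' where "Ps = join_prems n \<Sigma> \<Theta>' A" "\<And>j. j < n \<Longrightarrow> \<Theta> j \<subseteq> \<Theta>' j"
proof -
  have len: "length Ps = n" and sub: "\<And>j. j < n \<Longrightarrow> Irr (\<Sigma> j) (\<Theta> j) (A j) \<sqsubseteq> Ps ! j"
    using assms by (auto simp: join_prems_def list_all2_conv_all_nth)
  have "\<forall>j. \<exists>X. j < n \<longrightarrow> Ps ! j = Irr (\<Sigma> j) X (A j) \<and> \<Theta> j \<subseteq> X"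
    using sub by (metis Irr_subsumedE)
  then obtain \<Theta>' where \<Theta>': "\<And>j. j < n \<Longrightarrow> Ps ! j = Irr (\<Sigma> j) (\<Theta>' j) (A j) \<and> \<Theta> j \<subseteq> \<Theta>' j"
    by metis
  have "Ps = join_prems n \<Sigma> \<Theta>' A"
    by (rule nth_equalityI) (auto simp: len \<Theta>' join_prems_def)
  with \<Theta>' show thesis by (intro that) auto
qed

lemma join_bar:
  assumes "join_cond n \<Sigma> \<Theta> A" "\<forall>\<tau>\<in>set (join_prems n \<Sigma> \<Theta> A). frj_sequent G \<tau>"
  shows "Sig_At n \<Sigma> \<union> The_At n \<Theta> \<union> Sig_Imp n \<Sigma> \<union> The_Imp n \<Theta> A \<subseteq> bar G"
proof -
  have "0 < n" and *: "\<And>j. j < n \<Longrightarrow> \<Sigma> j \<subseteq> bar G \<and> \<Theta> j \<subseteq> bar G"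
    using assms by (auto simp: join_cond_def join_prems_def)
  have "Sig_At n \<Sigma> \<union> Sig_Imp n \<Sigma> \<subseteq> bar G"
    using * by (auto simp: Sig_At_def Sig_Imp_def)
  \<comment> \<open>Here \<open>n \<ge> 1\<close> matters: the intersection over an empty index
    range would be the set of all formulas.\<close>
  moreover have "The_At n \<Theta> \<union> The_Imp n \<Theta> A \<subseteq> \<Theta> 0"
    using \<open>0 < n\<close> by (auto simp: The_At_def The_Imp_def)
  ultimately show ?thesis using *[OF \<open>0 < n\<close>] by blast
qed

text \<open>Most side conditions are monotone in \<Gamma> and \<Theta> or depend only on \<Sigma>
  and the right formulas, so the same rule applies with the larger sets. Two cases need a new choice
  of \<Theta>: the disjointness in \<open>imp_in_irr\<close> and the maximality in
  \<open>imp_notin\<close>.\<close>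

lemma frj_rule_mono:
  assumes "frj_rule G Ps \<sigma>" "list_all2 (\<sqsubseteq>) Ps Qs" "\<forall>\<tau>\<in>set Qs. frj_sequent G \<tau>"
  obtains \<sigma>' where "frj_rule G Qs \<sigma>'" "\<sigma> \<sqsubseteq> \<sigma>'"
proof -
  from assms(1) have "rule_schema G Ps \<sigma>" and seq: "frj_sequent G \<sigma>"
    by (auto simp: frj_rule_def)
  then have "\<exists>\<sigma>'. rule_schema G Qs \<sigma>' \<and> frj_sequent G \<sigma>' \<and> \<sigma> \<sqsubseteq> \<sigma>'"
    using assms(2,3)
  proof cases
    case (and_reg C A1 A2 \<Gamma>)
    then obtain \<Gamma>' where "Qs = [Reg \<Gamma>' C]" "\<Gamma> \<subseteq> \<Gamma>'"
      using assms(2) by (auto simp: list_all2_Cons1 elim: Reg_subsumedE)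
    with and_reg assms(3) seq show ?thesis
      by (intro exI[of _ "Reg \<Gamma>' (And A1 A2)"])
        (auto intro: rule_schema.intros subsumed.intros)
  next
    case (and_irr C A1 A2 \<Sigma> \<Theta>)
    then obtain \<Theta>' where "Qs = [Irr \<Sigma> \<Theta>' C]" "\<Theta> \<subseteq> \<Theta>'"
      using assms(2) by (auto simp: list_all2_Cons1 elim: Irr_subsumedE)
    with and_irr assms(3) seq show ?thesis
      by (intro exI[of _ "Irr \<Sigma> \<Theta>' (And A1 A2)"])
        (auto intro: rule_schema.intros subsumed.intros)
  next
    case (or_irr \<Sigma>1 \<Sigma>2 \<Theta>2 \<Theta>1 C1 C2)
    then obtain X1 X2 where X: "Qs = [Irr \<Sigma>1 X1 C1, Irr \<Sigma>2 X2 C2]" "\<Theta>1 \<subseteq> X1" "\<Theta>2 \<subseteq> X2"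
      using assms(2) by (auto simp: list_all2_Cons1 elim!: Irr_subsumedE)
    have "rule_schema G Qs (Irr (\<Sigma>1 \<union> \<Sigma>2) (X1 \<inter> X2) (Or C1 C2))"
      unfolding X(1) by (rule rule_schema.or_irr) (use or_irr X in auto)
    moreover have "\<sigma> \<sqsubseteq> Irr (\<Sigma>1 \<union> \<Sigma>2) (X1 \<inter> X2) (Or C1 C2)"
      using or_irr X by (auto intro!: subsumed.intros)
    ultimately show ?thesis using or_irr X assms(3) seq by (intro exI conjI) auto
  next
    case (imp_in_reg A \<Gamma> B)
    then obtain \<Gamma>' where \<Gamma>': "Qs = [Reg \<Gamma>' B]" "\<Gamma> \<subseteq> \<Gamma>'"
      using assms(2) by (auto simp: list_all2_Cons1 elim: Reg_subsumedE)
    then have "A \<in> Cl \<Gamma>'" using imp_in_reg Cl_mono by blast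
    with \<Gamma>' imp_in_reg assms(3) seq show ?thesis
      by (intro exI[of _ "Reg \<Gamma>' (Imp A B)"])
        (auto intro: rule_schema.intros subsumed.intros)
  next
    case (imp_in_irr \<Theta> \<Lambda> A \<Sigma> B)
    then obtain X where X: "Qs = [Irr \<Sigma> X B]" "\<Theta> \<union> \<Lambda> \<subseteq> X"
      using assms(2) by (auto simp: list_all2_Cons1 elim!: Irr_subsumedE)
    \<comment> \<open>The same \<Lambda> is moved and the surplus stays behind. Closure and
      minimality mention only \<Sigma> and \<Lambda>, so they carry over, and
      \<open>X - \<Lambda>\<close> is disjoint from \<Lambda> by construction.\<close>
    have *: "X = (X - \<Lambda>) \<union> \<Lambda>" using X by auto
    have "rule_schema G [Irr \<Sigma> ((X - \<Lambda>) \<union> \<Lambda>) B] (Irr (\<Sigma> \<union> \<Lambda>) (X - \<Lambda>) (Imp A B))"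
      by (rule rule_schema.imp_in_irr) (use imp_in_irr in auto)
    then have "rule_schema G Qs (Irr (\<Sigma> \<union> \<Lambda>) (X - \<Lambda>) (Imp A B))"
      using X(1) * by simp
    moreover have "\<sigma> \<sqsubseteq> Irr (\<Sigma> \<union> \<Lambda>) (X - \<Lambda>) (Imp A B)"
      using imp_in_irr X by (auto intro!: subsumed.intros)
    ultimately show ?thesis using imp_in_irr X assms(3) seq by (intro exI conjI) auto
  next
    case (imp_notin \<Theta> \<Gamma> A B)
    then obtain \<Gamma>' where \<Gamma>': "Qs = [Reg \<Gamma>' B]" "\<Gamma> \<subseteq> \<Gamma>'"
      using assms(2) by (auto simp: list_all2_Cons1 elim: Reg_subsumedE)
    have Cl: "Cl \<Gamma> \<subseteq> Cl \<Gamma>'" using \<Gamma>' by (simp add: Cl_mono)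
    \<comment> \<open>The old \<Theta> may fail to be maximal inside the larger
      \<open>Cl \<Gamma>' \<inter> bar G\<close>, so it is extended to a maximal set there. The new
      conclusion still subsumes the old one, since both have an empty first component.\<close>
    obtain \<Theta>' where \<Theta>': "\<Theta> \<subseteq> \<Theta>'" "\<Theta>' \<subseteq> Cl \<Gamma>' \<inter> bar G" "A \<notin> Cl \<Theta>'"
      "\<forall>\<Theta>''. \<Theta>' \<subset> \<Theta>'' \<and> \<Theta>'' \<subseteq> Cl \<Gamma>' \<inter> bar G \<longrightarrow> A \<in> Cl \<Theta>''"
      by (rule maximal_set_avoiding_Cl[of "Cl \<Gamma>' \<inter> bar G" \<Theta> A])
        (use imp_notin Cl finite_bar in auto)
    have "rule_schema G Qs (Irr {} \<Theta>' (Imp A B))"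
      unfolding \<Gamma>'(1) by (rule rule_schema.imp_notin) (use imp_notin Cl \<Theta>' in auto)
    moreover have "\<sigma> \<sqsubseteq> Irr {} \<Theta>' (Imp A B)"
      using imp_notin \<Theta>' by (auto intro: subsumed.intros)
    ultimately show ?thesis using imp_notin \<Theta>' seq by (intro exI conjI) auto
  next
    case (join_At n \<Sigma> \<Theta> A F)
    from assms(2) join_At(1) obtain \<Theta>' where
      Qs: "Qs = join_prems n \<Sigma> \<Theta>' A" and sub: "\<And>j. j < n \<Longrightarrow> \<Theta> j \<subseteq> \<Theta>' j"
      by (auto elim: join_prems_subsumedE)
    let ?\<Gamma> = "Sig_At n \<Sigma> \<union> (The_At n \<Theta>' - {F}) \<union> Sig_Imp n \<Sigma> \<union> The_Imp n \<Theta>' A"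
    have cond: "join_cond n \<Sigma> \<Theta>' A" using join_At sub by (blast intro: join_cond_mono)
    have mono: "The_At n \<Theta> \<subseteq> The_At n \<Theta>'" "The_Imp n \<Theta> A \<subseteq> The_Imp n \<Theta>' A"
      by (intro The_At_mono The_Imp_mono sub; assumption)+
    have "rule_schema G Qs (Reg ?\<Gamma> F)"
      unfolding Qs by (rule rule_schema.join_At) (use cond join_At in auto)
    moreover have "frj_sequent G (Reg ?\<Gamma> F)"
      using join_bar[OF cond, of G] assms(3) Qs join_At seq by auto
    moreover have "\<sigma> \<sqsubseteq> Reg ?\<Gamma> F"
      unfolding join_At(2) by (rule sub_reg)
        (use mono in blast)
    ultimately show ?thesis by blast
  next
    case (join_Or n \<Sigma> \<Theta> A C1 C2)
    from assms(2) join_Or(1) obtain \<Theta>' where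
      Qs: "Qs = join_prems n \<Sigma> \<Theta>' A" and sub: "\<And>j. j < n \<Longrightarrow> \<Theta> j \<subseteq> \<Theta>' j"
      by (auto elim: join_prems_subsumedE)
    let ?\<Gamma> = "Sig_At n \<Sigma> \<union> The_At n \<Theta>' \<union> Sig_Imp n \<Sigma> \<union> The_Imp n \<Theta>' A"
    have cond: "join_cond n \<Sigma> \<Theta>' A" using join_Or sub by (blast intro: join_cond_mono)
    have mono: "The_At n \<Theta> \<subseteq> The_At n \<Theta>'" "The_Imp n \<Theta> A \<subseteq> The_Imp n \<Theta>' A"
      by (intro The_At_mono The_Imp_mono sub; assumption)+
    have "rule_schema G Qs (Reg ?\<Gamma> (Or C1 C2))"
      unfolding Qs by (rule rule_schema.join_Or) (use cond join_Or in auto)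
    moreover have "frj_sequent G (Reg ?\<Gamma> (Or C1 C2))"
      using join_bar[OF cond, of G] assms(3) Qs join_Or seq by auto
    moreover have "\<sigma> \<sqsubseteq> Reg ?\<Gamma> (Or C1 C2)"
      unfolding join_Or(2) by (rule sub_reg)
        (use mono in blast)
    ultimately show ?thesis by blast
  qed
  then show thesis using assms(3) that by (auto simp: frj_rule_def)
qed

section \<open>Saturation\<close>

definition covers :: "sequent set \<Rightarrow> sequent \<Rightarrow> bool" where
  "covers DB \<sigma> \<longleftrightarrow> (\<exists>\<sigma>' \<in> DB. \<sigma> \<sqsubseteq> \<sigma>')"

lemma covers_mono: "covers DB \<sigma> \<Longrightarrow> DB \<subseteq> DB' \<Longrightarrow> covers DB' \<sigma>"
  by (auto simp: covers_def)

lemma covers_member: "\<sigma> \<in> DB \<Longrightarrow> covers DB \<sigma>"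
  using subsumed_refl by (auto simp: covers_def)

lemma frj_derivation_root: "frj_derivation G d \<Longrightarrow> frj_sequent G (root d)"
  by (auto elim!: frj_derivation.cases simp: frj_axiom_def frj_rule_def)

text \<open>Induction on the derivation: premises are replaced by members of \<open>DB\<close> that
  subsume them, \<open>frj_rule_mono\<close> turns the last inference into an instance over
  \<open>DB\<close>, and transitivity combines the two subsumptions.\<close>

lemma covers_derivation:
  assumes seq: "\<forall>\<sigma>\<in>DB. frj_sequent G \<sigma>"
    and ax: "\<And>\<sigma>. frj_axiom G \<sigma> \<Longrightarrow> covers DB \<sigma>"
    and inst: "\<And>S \<sigma>. (S, \<sigma>) \<in> instances G DB \<Longrightarrow> covers DB \<sigma>"
    and d: "frj_derivation G d"
  shows "covers DB (root d)"
  using d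
proof induction
  case (der_axiom \<sigma>)
  then show ?case by (simp add: ax)
next
  case (der_rule ds \<sigma>)
  then have "\<forall>d\<in>set ds. \<exists>\<tau>. \<tau> \<in> DB \<and> root d \<sqsubseteq> \<tau>"
    by (auto simp: covers_def)
  then obtain f where f: "\<forall>d\<in>set ds. f d \<in> DB \<and> root d \<sqsubseteq> f d"
    by metis
  have "list_all2 (\<sqsubseteq>) (map root ds) (map f ds)"
    using f by (auto simp: list_all2_conv_all_nth)
  moreover have "\<forall>\<tau>\<in>set (map f ds). frj_sequent G \<tau>"
    using f seq by auto
  ultimately obtain \<sigma>' where \<sigma>': "frj_rule G (map f ds) \<sigma>'" "\<sigma> \<sqsubseteq> \<sigma>'"
    using der_rule.hyps by (blast elim: frj_rule_mono)
  have "(set (map f ds), \<sigma>') \<in> instances G DB"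
    unfolding instances_def using \<sigma>' f by fastforce
  then have "covers DB \<sigma>'" by (rule inst)
  with \<sigma>' show ?case by (auto simp: covers_def intro: subsumed_trans)
qed

lemma saturated_databaseI:
  assumes "\<forall>\<sigma>\<in>DB. frj_derivable G \<sigma>"
    and "\<And>\<sigma>. frj_axiom G \<sigma> \<Longrightarrow> covers DB \<sigma>"
    and "\<And>S \<sigma>. (S, \<sigma>) \<in> instances G DB \<Longrightarrow> covers DB \<sigma>"
  shows "saturated_database G DB"
proof -
  have seq: "\<forall>\<sigma>\<in>DB. frj_sequent G \<sigma>"
    using assms(1) frj_derivation_root by (auto simp: frj_derivable_def)
  have "covers DB \<sigma>" if "frj_derivable G \<sigma>" for \<sigma>
    using that covers_derivation[OF seq assms(2,3)] by (auto simp: frj_derivable_def)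
  with assms(1) seq show ?thesis
    by (auto simp: saturated_database_def database_def covers_def)
qed

section \<open>Runs of the procedure\<close>

text \<open>Every tree in \<open>D\<close> must be a derivation, so the result is correct whichever
  recorded tree \<open>return_derivation\<close> picks.\<close>

definition recorded :: "form \<Rightarrow> sequent set \<Rightarrow> deriv set \<Rightarrow> bool" where
  "recorded G X D \<longleftrightarrow> X \<subseteq> root ` D \<and> (\<forall>d\<in>D. frj_derivation G d)"

lemma recorded_derivable: "recorded G X D \<Longrightarrow> \<sigma> \<in> X \<Longrightarrow> frj_derivable G \<sigma>"
  by (auto simp: recorded_def frj_derivable_def)

lemma recorded_sequents: "recorded G X D \<Longrightarrow> X \<subseteq> {\<sigma>. frj_sequent G \<sigma>}"
  by (auto simp: recorded_def dest!: frj_derivation_root)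

text \<open>Inside the for loop only the pending instances \<open>P\<close> may be uncovered; once
  \<open>P\<close> is empty this becomes the \<open>While\<close> clause, which for
  \<open>I = {}\<close> gives saturation. Disjointness of \<open>I\<close> and \<open>DB\<close>
  serves termination. The \<open>Done\<close> clause is the required specification.\<close>

primrec fsearch_inv :: "form \<Rightarrow> config \<Rightarrow> bool" where
  "fsearch_inv G (While DB I D) \<longleftrightarrow> recorded G (DB \<union> I) D \<and> I \<inter> DB = {} \<and>
     (\<forall>\<sigma>. frj_axiom G \<sigma> \<longrightarrow> covers (DB \<union> I) \<sigma>) \<and>
     (\<forall>(S, \<sigma>) \<in> instances G DB. covers (DB \<union> I) \<sigma>)"
| "fsearch_inv G (For DB I D P) \<longleftrightarrow> recorded G (DB \<union> I) D \<and> I \<inter> DB = {} \<and>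
     (\<forall>\<sigma>. frj_axiom G \<sigma> \<longrightarrow> covers (DB \<union> I) \<sigma>) \<and> P \<subseteq> instances G DB \<and>
     (\<forall>(S, \<sigma>) \<in> instances G DB - P. covers (DB \<union> I) \<sigma>)"
| "fsearch_inv G (Done r) \<longleftrightarrow>
     (\<exists>d. r = Derivation d \<and> frj_derivation_of_goal G d) \<or>
     (\<exists>DB. r = Database DB \<and> saturated_database G DB)"

text \<open>Makes the invariant hold initially: over the empty \<open>DB\<close> there are no
  instances. For join rules the reason is \<open>n \<ge> 1\<close>.\<close>

lemma no_premise_free_rule: "\<not> rule_schema G [] \<sigma>"
  by (auto elim!: rule_schema.cases simp: join_prems_def join_cond_def)

lemma fsearch_inv_init: "fsearch_inv G (fsearch_init G)"
  using no_premise_free_rule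
  by (force simp: fsearch_init_def recorded_def instances_def frj_rule_def
      intro: covers_member der_axiom)

lemma fsearch_inv_step:
  assumes "fsearch_step G c c'" "fsearch_inv G c"
  shows "fsearch_inv G c'"
  using assms
proof cases
  case (enter I DB D)
  with assms(2) show ?thesis by auto
next
  case (skip S \<sigma> P DB I D)
  then have "covers (DB \<union> I) \<sigma>" by (auto simp: covers_def)
  with skip assms(2) show ?thesis by auto
next
  case (add S \<sigma> P DB ds D I)
  let ?I = "insert \<sigma> I"
  have "recorded G (DB \<union> ?I) (insert (Node \<sigma> ds) D)"
    using add assms(2) by (auto simp: recorded_def intro!: der_rule)
  \<comment> \<open>A member of \<open>DB\<close> would subsume itself, contrary to the guard of
    \<open>add\<close>.\<close>
  moreover have "\<sigma> \<notin> DB" using add subsumed_refl by blast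
  moreover have mono: "covers (DB \<union> ?I) \<tau>" if "covers (DB \<union> I) \<tau>" for \<tau>
    using that by (rule covers_mono) auto
  moreover have "covers (DB \<union> ?I) \<tau>" if "(T, \<tau>) \<in> instances G DB - (P - {(S, \<sigma>)})" for T \<tau>
  \<comment> \<open>The visited instance is covered by its own conclusion, now in \<open>?I\<close>;
    every other instance no longer pending was covered before.\<close>
  proof (cases "(T, \<tau>) = (S, \<sigma>)")
    case True
    then show ?thesis by (simp add: covers_member)
  next
    case False
    then have "covers (DB \<union> I) \<tau>" using that add(1) assms(2) by auto
    then show ?thesis by (rule mono)
  qed
  ultimately show ?thesis using add(1,2) assms(2) by auto
next
  case (leave DB I D)
  with assms(2) show ?thesis by auto
next
  case (return_derivation \<Gamma> DB d D I)
  with assms(2) show ?thesis by (auto simp: recorded_def frj_derivation_of_goal_def)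
next
  case (return_database I DB D)
  then have "saturated_database G DB"
    using assms(2) by (intro saturated_databaseI) (auto intro: recorded_derivable)
  with return_database show ?thesis by simp
qed

lemma fsearch_inv_reaches: "fsearch_reaches G c \<Longrightarrow> fsearch_inv G c"
  unfolding fsearch_reaches_def
  by (induction rule: rtranclp_induct) (auto intro: fsearch_inv_init fsearch_inv_step)

section \<open>Absence of stuck configurations\<close>

lemma recorded_list:
  assumes "recorded G X D" "set Ps \<subseteq> X"
  obtains ds where "set ds \<subseteq> D" "map root ds = Ps"
proof -
  have "Ps \<in> lists (root ` D)" using assms by (auto simp: recorded_def)
  then show thesis using that by (auto simp: lists_image)
qed

text \<open>The critical configuration is a for loop with a pending, unsubsumed instance:
  \<open>add\<close> needs recorded derivations of all premises, and the invariant provides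
  them.\<close>

lemma fsearch_progress:
  assumes "fsearch_inv G c" "\<nexists>c'. fsearch_step G c c'"
  shows "\<exists>r. c = Done r"
proof (cases c)
  case (While DB I D)
  show ?thesis
  proof (cases "goal_found G DB")
    case True
    then obtain \<Gamma> where \<Gamma>: "Reg \<Gamma> G \<in> DB" by (auto simp: goal_found_def)
    then obtain d where "d \<in> D" "root d = Reg \<Gamma> G"
      using assms(1) While by (auto simp: recorded_def)
    with \<Gamma> show ?thesis using assms(2) While return_derivation by blast
  next
    case False
    then show ?thesis using assms(2) While enter return_database by (cases "I = {}") blast+
  qed
next
  case (For DB I D P)
  show ?thesis
  proof (cases "P = {}")
    case True
    then show ?thesis using assms(2) For leave by blast
  next
    case False
    then obtain S \<sigma> where P: "(S, \<sigma>) \<in> P" by auto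
    then have "(S, \<sigma>) \<in> instances G DB" using assms(1) For by auto
    \<comment> \<open>A pending pair keeps only the set of premises; membership in
      \<open>instances\<close> gives back a list to which the rule applies.\<close>
    then obtain Ps where Ps: "S = set Ps" "frj_rule G Ps \<sigma>" "set Ps \<subseteq> DB \<union> I"
      by (auto simp: instances_def)
    from assms(1) For Ps(3) obtain ds where "set ds \<subseteq> D" "map root ds = Ps"
      by (auto elim: recorded_list)
    with P Ps show ?thesis using assms(2) For skip add by metis
  qed
qed simp

section \<open>Termination by a lexicographic measure\<close>

primrec fsearch_measure :: "form \<Rightarrow> config \<Rightarrow> nat \<times> nat \<times> nat" where
  "fsearch_measure G (While DB I D) = (card ({\<sigma>. frj_sequent G \<sigma>} - DB), 1, 0)"
| "fsearch_measure G (For DB I D P) = (card ({\<sigma>. frj_sequent G \<sigma>} - DB), 2, card P)"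
| "fsearch_measure G (Done r) = (0, 0, 0)"

text \<open>Entering the for loop raises the phase number from 1 to 2, so there the count of
  sequents outside \<open>DB\<close> must drop. Visiting an instance shrinks \<open>P\<close>;
  leaving the loop or returning lowers the phase if the first component is unchanged.\<close>

lemma fsearch_measure_step:
  assumes "fsearch_step G c c'" "fsearch_inv G c"
  shows "(fsearch_measure G c', fsearch_measure G c) \<in> less_than <*lex*> less_than <*lex*> less_than"
  using assms
proof cases
  case (enter I DB D)
  \<comment> \<open>The drop is strict because \<open>I\<close> is nonempty, disjoint from
    \<open>DB\<close> and consists of sequents counted by the measure.\<close>
  then have "I \<subseteq> {\<sigma>. frj_sequent G \<sigma>}" "I \<inter> DB = {}"
    using assms(2) recorded_sequents[of G "DB \<union> I" D] by auto
  then have "{\<sigma>. frj_sequent G \<sigma>} - (DB \<union> I) \<subset> {\<sigma>. frj_sequent G \<sigma>} - DB"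
    using enter by blast
  then have "card ({\<sigma>. frj_sequent G \<sigma>} - (DB \<union> I)) < card ({\<sigma>. frj_sequent G \<sigma>} - DB)"
    by (intro psubset_card_mono) (simp add: finite_frj_sequents)
  with enter show ?thesis by simp
next
  case (skip S \<sigma> P DB I D)
  then have "finite P" using assms(2) by (auto intro: finite_subset[OF _ finite_instances])
  then have "card (P - {(S, \<sigma>)}) < card P" using skip by (intro card_Diff1_less)
  with skip show ?thesis by simp
next
  case (add S \<sigma> P DB ds D I)
  then have "finite P" using assms(2) by (auto intro: finite_subset[OF _ finite_instances])
  then have "card (P - {(S, \<sigma>)}) < card P" using add by (intro card_Diff1_less)
  with add show ?thesis by simp
qed auto

lemma no_infinite_run:
  assumes "c 0 = fsearch_init G" "\<forall>i. fsearch_step G (c i) (c (Suc i))"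
  shows False
\<comment> \<open>The measure is known to decrease only under the invariant, so each configuration
  of the run is first shown reachable.\<close>
proof -
  have "fsearch_reaches G (c i)" for i
    by (induction i)
      (use assms in \<open>auto simp: fsearch_reaches_def intro: rtranclp.rtrancl_into_rtrancl\<close>)
  then have "\<forall>i. (fsearch_measure G (c (Suc i)), fsearch_measure G (c i))
      \<in> less_than <*lex*> less_than <*lex*> less_than"
    using assms(2) fsearch_inv_reaches fsearch_measure_step by blast
  moreover have "wf (less_than <*lex*> less_than <*lex*> less_than)"
    by (intro wf_lex_prod wf_less_than)
  ultimately show False
    unfolding wf_iff_no_infinite_down_chain by (elim notE) (rule exI)
qed

theorem theorem4p2:
  fixes G :: form
  shows "fsearch_terminates G \<and>
    (\<forall>r. fsearch_returns G r \<longrightarrow>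
      (\<exists>d. r = Derivation d \<and> frj_derivation_of_goal G d) \<or>
      (\<exists>DB. r = Database DB \<and> saturated_database G DB))"
proof (intro conjI allI impI)
  show "fsearch_terminates G"
    unfolding fsearch_terminates_def
    using no_infinite_run fsearch_progress fsearch_inv_reaches by blast
next
  fix r assume "fsearch_returns G r"
  then show "(\<exists>d. r = Derivation d \<and> frj_derivation_of_goal G d) \<or>
      (\<exists>DB. r = Database DB \<and> saturated_database G DB)"
    using fsearch_inv_reaches[of G "Done r"] by (simp add: fsearch_returns_def)
qed

end
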